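(* Let $R$ be a $UJ^{\#}$ ring. Then: (1) an element $a\in R$ is clean if and only if it is $J^{\#}$-clean; (2) an element $a\in R$ is strongly clean if and only if it is strongly $J^{\#}$-clean.
   Context: All rings are associative with identity. $J(R)$ is the Jacobson radical and $U(R)$ the group of units of $R$. Define $J^{\#}(R)=\{z\in R : z^n\in J(R)\text{ for some } n\ge 1\}$. A ring $R$ is called a $UJ^{\#}$ ring if $U(R)=1+J^{\#}(R)$. An element $a\in R$ is clean if $a=e+u$ with $e$ idempotent and $u\in U(R)$, and strongly clean if moreover $e,u$ can be chosen with $eu=ue$. An element $a\in R$ is $J^{\#}$-clean if there is an idempotent $e\in R$ with $a-e\in J^{\#}(R)$, and strongly $J^{\#}$-clean if moreover $e$ can be chosen with $ea=ae$. *)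

theory Defs
  imports "HOL-Algebra.Ideal"
begin

locale left_ideal = additive_subgroup I R + ring R for I and R (structure) +
  assumes l_closed: "\<lbrakk>a \<in> I; x \<in> carrier R\<rbrakk> \<Longrightarrow> x \<otimes> a \<in> I"

locale maximal_left_ideal = left_ideal +
  assumes I_notcarr: "carrier R \<noteq> I"
    and I_maximal: "\<lbrakk>left_ideal K R; I \<subseteq> K; K \<subseteq> carrier R\<rbrakk> \<Longrightarrow> K = I \<or> K = carrier R"

text \<open>
  Rings need not be commutative, so the intersection ranges over the maximal left ideals;
  the predicate maximalideal of HOL-Algebra is the two-sided notion. Restricting to the carrier makes
  the empty intersection (zero ring) equal to the whole ring.
\<close>

definition jacobson_radical :: "('a, 'm) ring_scheme \<Rightarrow> 'a set" where
  "jacobson_radical R = {x \<in> carrier R. \<forall>M. maximal_left_ideal M R \<longrightarrow> x \<in> M}"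

definition J_sharp :: "('a, 'm) ring_scheme \<Rightarrow> 'a set" where
  "J_sharp R = {z \<in> carrier R. \<exists>n::nat. 1 \<le> n \<and> z [^]\<^bsub>R\<^esub> n \<in> jacobson_radical R}"

definition idempotents :: "('a, 'm) ring_scheme \<Rightarrow> 'a set" where
  "idempotents R = {e \<in> carrier R. e \<otimes>\<^bsub>R\<^esub> e = e}"

definition UJ_sharp_ring :: "('a, 'm) ring_scheme \<Rightarrow> bool" where
  "UJ_sharp_ring R \<longleftrightarrow> ring R \<and> Units R = {\<one>\<^bsub>R\<^esub> \<oplus>\<^bsub>R\<^esub> z | z. z \<in> J_sharp R}"

definition clean :: "('a, 'm) ring_scheme \<Rightarrow> 'a \<Rightarrow> bool" where
  "clean R a \<longleftrightarrow> (\<exists>e \<in> idempotents R. \<exists>u \<in> Units R. a = e \<oplus>\<^bsub>R\<^esub> u)"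

definition strongly_clean :: "('a, 'm) ring_scheme \<Rightarrow> 'a \<Rightarrow> bool" where
  "strongly_clean R a \<longleftrightarrow>
    (\<exists>e \<in> idempotents R. \<exists>u \<in> Units R. a = e \<oplus>\<^bsub>R\<^esub> u \<and> e \<otimes>\<^bsub>R\<^esub> u = u \<otimes>\<^bsub>R\<^esub> e)"

definition J_sharp_clean :: "('a, 'm) ring_scheme \<Rightarrow> 'a \<Rightarrow> bool" where
  "J_sharp_clean R a \<longleftrightarrow> (\<exists>e \<in> idempotents R. a \<ominus>\<^bsub>R\<^esub> e \<in> J_sharp R)"

definition strongly_J_sharp_clean :: "('a, 'm) ring_scheme \<Rightarrow> 'a \<Rightarrow> bool" where
  "strongly_J_sharp_clean R a \<longleftrightarrow>
    (\<exists>e \<in> idempotents R. a \<ominus>\<^bsub>R\<^esub> e \<in> J_sharp R \<and> e \<otimes>\<^bsub>R\<^esub> a = a \<otimes>\<^bsub>R\<^esub> e)"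

end

theory Submission
  imports Defs
begin

text \<open>
  Since \<open>-1\<close> is a unit, \<open>c = -2\<close> lies in \<open>J\<^sup>#\<close>; being central, it lies in the Jacobson radical,
  and adding a multiple of \<open>c\<close> to an element of \<open>J\<^sup>#\<close> stays in \<open>J\<^sup>#\<close>. If \<open>e\<close> is idempotent, then
  so is \<open>f = 1 - e\<close>, and \<open>a = e + (1 + z)\<close> holds iff \<open>a - f = z + 2e\<close>. Hence passing from \<open>e\<close> to
  \<open>f\<close> exchanges decompositions with a unit and decompositions with an element of \<open>J\<^sup>#\<close>.
\<close>

context ring
begin

text \<open>The set is \<open>M + Rc\<close>, the candidate against which the maximality of
  \<open>M\<close> is tested below.\<close>

lemma left_ideal_add_principal:
  assumes "left_ideal M R" and c: "c \<in> carrier R"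
  shows "left_ideal {m \<oplus> t \<otimes> c | m t. m \<in> M \<and> t \<in> carrier R} R" (is "left_ideal ?K R")
proof -
  interpret M: left_ideal M R by (fact assms)
  note [simp] = M.a_Hcarr c
  show ?thesis
  proof (intro left_ideal.intro left_ideal_axioms.intro ring_axioms additive_subgroupI)
    show "subgroup ?K (add_monoid R)"
    proof (rule add.subgroupI)
      show "?K \<subseteq> carrier R" by auto
      show "?K \<noteq> {}" using M.zero_closed by blast
    next
      fix a assume "a \<in> ?K"
      then obtain m t where a: "a = m \<oplus> t \<otimes> c" and m: "m \<in> M" and t: "t \<in> carrier R" by blast
      have "\<ominus> a = \<ominus> m \<oplus> (\<ominus> t) \<otimes> c" using m t by (simp add: a minus_add l_minus)
      with m t show "\<ominus> a \<in> ?K" using M.a_inv_closed by blast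
    next
      fix a b assume "a \<in> ?K" "b \<in> ?K"
      then obtain m t m' t' where a: "a = m \<oplus> t \<otimes> c" "b = m' \<oplus> t' \<otimes> c"
        and m: "m \<in> M" "m' \<in> M" and t: "t \<in> carrier R" "t' \<in> carrier R" by blast
      have "a \<oplus> b = (m \<oplus> m') \<oplus> (t \<oplus> t') \<otimes> c" using m t by (simp add: a l_distr a_ac)
      with m t show "a \<oplus> b \<in> ?K" using M.a_closed by blast
    qed
  next
    fix a x assume "a \<in> ?K" and x: "x \<in> carrier R"
    then obtain m t where a: "a = m \<oplus> t \<otimes> c" and m: "m \<in> M" and t: "t \<in> carrier R" by blast
    have "x \<otimes> a = x \<otimes> m \<oplus> (x \<otimes> t) \<otimes> c" using m t x by (simp add: a r_distr m_assoc)
    with m t x show "x \<otimes> a \<in> ?K" using M.l_closed by blast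
  qed
qed

text \<open>\<open>M + Rc\<close> contains both \<open>M\<close> and \<open>c\<close>, so it is
  strictly larger than \<open>M\<close>; maximality makes it the whole ring, and
  \<open>\<one>\<close> decomposes in it.\<close>

lemma maximal_left_ideal_decomp_one:
  assumes "maximal_left_ideal M R" and c: "c \<in> carrier R" "c \<notin> M"
  obtains m t where "m \<in> M" "t \<in> carrier R" "\<one> = m \<oplus> t \<otimes> c"
proof -
  interpret M: maximal_left_ideal M R by (fact assms)
  note [simp] = M.a_Hcarr c
  let ?K = "{m \<oplus> t \<otimes> c | m t. m \<in> M \<and> t \<in> carrier R}"
  have "m \<in> ?K" if "m \<in> M" for m
  proof -
    have "m = m \<oplus> \<zero> \<otimes> c" using that by simp
    with that show ?thesis by blast
  qed
  moreover have "c \<in> ?K"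
  proof -
    have "c = \<zero> \<oplus> \<one> \<otimes> c" by simp
    then show ?thesis using M.zero_closed by blast
  qed
  moreover have "?K \<subseteq> carrier R" by auto
  ultimately have "?K = carrier R"
    using M.I_maximal[OF left_ideal_add_principal[OF M.left_ideal_axioms c(1)]] c(2) by blast
  then have "\<one> \<in> ?K" by blast
  then show thesis using that by blast
qed

text \<open>A maximal left ideal can contain a power of an element without containing the element;
  centrality excludes this. If \<open>c\<close> were outside \<open>M\<close>, multiplying
  \<open>\<one> = m \<oplus> t \<otimes> c\<close> by a power of \<open>c\<close> would lower the
  exponent by one, and the induction hypothesis would put \<open>c\<close> into
  \<open>M\<close>.\<close>

lemma central_pow_in_maximal_left_ideal:
  assumes "maximal_left_ideal M R" and c: "c \<in> carrier R"
    and central: "\<And>x. x \<in> carrier R \<Longrightarrow> c \<otimes> x = x \<otimes> c"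
    and "c [^] (n::nat) \<in> M"
  shows "c \<in> M"
  using \<open>c [^] n \<in> M\<close>
proof (induction n)
  case 0
  interpret M: maximal_left_ideal M R by (fact assms)
  \<comment> \<open>For exponent 0 the hypothesis says \<open>\<one> \<in> M\<close>, so absorption
    gives the claim directly.\<close>
  have "c \<otimes> \<one> \<in> M" using 0 M.l_closed[of \<one> c] c by simp
  with c show ?case by simp
next
  case (Suc n)
  interpret M: maximal_left_ideal M R by (fact assms)
  show ?case
  proof (rule ccontr)
    assume "c \<notin> M"
    then obtain m t where m: "m \<in> M" and t: "t \<in> carrier R" and one: "\<one> = m \<oplus> t \<otimes> c"
      using maximal_left_ideal_decomp_one[OF assms(1) c] by blast
    note [simp] = M.a_Hcarr[OF m] t c
    have "c [^] n = c [^] n \<otimes> (m \<oplus> t \<otimes> c)" using one[symmetric] by simp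
    also have "\<dots> = c [^] n \<otimes> m \<oplus> c [^] n \<otimes> (c \<otimes> t)" by (simp add: r_distr central[OF t])
    also have "c [^] n \<otimes> (c \<otimes> t) = c [^] Suc n \<otimes> t" by (simp add: m_assoc)
    \<comment> \<open>\<open>M\<close> absorbs factors on the left only, so the power of
      \<open>c\<close> has to be moved to the right of \<open>t\<close>.\<close>
    also have "c [^] Suc n \<otimes> t = t \<otimes> c [^] Suc n"
      by (rule group_commutes_pow) (simp_all add: central)
    also have "c [^] n \<otimes> m \<oplus> t \<otimes> c [^] Suc n \<in> M"
      using Suc.prems m by (intro M.a_closed M.l_closed) auto
    finally show False using Suc.IH \<open>c \<notin> M\<close> by blast
  qed
qed

lemma central_in_jacobson_radical:
  assumes "c \<in> J_sharp R" and "\<And>x. x \<in> carrier R \<Longrightarrow> c \<otimes> x = x \<otimes> c"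
  shows "c \<in> jacobson_radical R"
  using assms central_pow_in_maximal_left_ideal
  unfolding J_sharp_def jacobson_radical_def by blast

text \<open>As \<open>c\<close> is central, \<open>Rc\<close> is a two-sided ideal, and powers can
  be compared modulo it. The correction has \<open>c\<close> on the right, the form that left ideals
  absorb.\<close>

lemma pow_add_central_multiple:
  assumes [simp]: "c \<in> carrier R" "x \<in> carrier R" "z \<in> carrier R"
    and central: "\<And>y. y \<in> carrier R \<Longrightarrow> c \<otimes> y = y \<otimes> c"
  shows "\<exists>w \<in> carrier R. (z \<oplus> x \<otimes> c) [^] (n::nat) = z [^] n \<oplus> w \<otimes> c"
proof (induction n)
  case 0
  show ?case by (rule bexI[of _ \<zero>]) simp_all
next
  case (Suc n)
  then obtain w where [simp]: "w \<in> carrier R"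
    and w: "(z \<oplus> x \<otimes> c) [^] n = z [^] n \<oplus> w \<otimes> c" by blast
  have "(z \<oplus> x \<otimes> c) [^] Suc n
      = z [^] Suc n \<oplus> (z [^] n \<otimes> (x \<otimes> c) \<oplus> (w \<otimes> (c \<otimes> z) \<oplus> w \<otimes> c \<otimes> x \<otimes> c))"
    by (simp add: w l_distr r_distr m_assoc a_ac)
  \<comment> \<open>Commuting \<open>c\<close> with \<open>z\<close> in the middle term lets
    \<open>c\<close> be factored out on the right.\<close>
  also have "\<dots> = z [^] Suc n \<oplus> (z [^] n \<otimes> x \<oplus> (w \<otimes> z \<oplus> w \<otimes> c \<otimes> x)) \<otimes> c"
    by (simp add: central[of z] l_distr m_assoc)
  finally show ?case by (rule bexI) simp
qed

text \<open>The exponent \<open>n\<close> that works for \<open>z\<close> also works for the sum: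
  the two powers differ by a multiple of \<open>c\<close>, which lies in every maximal left
  ideal.\<close>

lemma J_sharp_add_central_multiple:
  assumes z: "z \<in> J_sharp R" and x: "x \<in> carrier R" and c: "c \<in> jacobson_radical R"
    and central: "\<And>y. y \<in> carrier R \<Longrightarrow> c \<otimes> y = y \<otimes> c"
  shows "z \<oplus> x \<otimes> c \<in> J_sharp R"
proof -
  from z obtain n :: nat where [simp]: "z \<in> carrier R" and n: "1 \<le> n"
    and zn: "z [^] n \<in> jacobson_radical R" unfolding J_sharp_def by blast
  have [simp]: "c \<in> carrier R" using c by (simp add: jacobson_radical_def)
  obtain w where w: "w \<in> carrier R" and eq: "(z \<oplus> x \<otimes> c) [^] n = z [^] n \<oplus> w \<otimes> c"
    using pow_add_central_multiple[of c x z n] x central by auto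
  have "(z \<oplus> x \<otimes> c) [^] n \<in> M" if "maximal_left_ideal M R" for M
  proof -
    interpret M: maximal_left_ideal M R by (fact that)
    show ?thesis
      unfolding eq using zn c w that
      by (intro M.a_closed M.l_closed) (auto simp: jacobson_radical_def)
  qed
  then show ?thesis using n x by (auto simp: J_sharp_def jacobson_radical_def)
qed

lemma idempotent_complement:
  assumes "e \<in> idempotents R"
  shows "\<one> \<ominus> e \<in> idempotents R"
proof -
  have [simp]: "e \<in> carrier R" and "e \<otimes> e = e" using assms by (auto simp: idempotents_def)
  then show ?thesis
    by (simp add: idempotents_def a_minus_def l_distr r_distr l_minus r_minus r_neg l_neg a_assoc)
qed

lemma complement_commutes:
  assumes "e \<in> carrier R" "a \<in> carrier R" "e \<otimes> a = a \<otimes> e"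
  shows "(\<one> \<ominus> e) \<otimes> a = a \<otimes> (\<one> \<ominus> e)"
  using assms by (simp add: a_minus_def l_distr r_distr l_minus r_minus)

lemma UJ_sharp_add_double:
  assumes UJ: "UJ_sharp_ring R" and z: "z \<in> J_sharp R" and x: "x \<in> carrier R"
  shows "z \<oplus> (x \<oplus> x) \<in> J_sharp R"
proof -
  let ?c = "\<ominus> (\<one> \<oplus> \<one>)"
  have central: "?c \<otimes> y = y \<otimes> ?c" if "y \<in> carrier R" for y
    using that by (simp add: l_distr r_distr l_minus r_minus)
  have "\<ominus> \<one> \<in> Units R" by (rule Units_minus_one_closed)
  then obtain c where c: "c \<in> J_sharp R" and "\<ominus> \<one> = \<one> \<oplus> c"
    using UJ unfolding UJ_sharp_ring_def by blast
  moreover from c have "c \<in> carrier R" by (simp add: J_sharp_def)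
  \<comment> \<open>Solving \<open>\<ominus> \<one> = \<one> \<oplus> c\<close> for \<open>c\<close>
    identifies it with -2.\<close>
  then have "c = \<ominus> \<one> \<oplus> (\<one> \<oplus> c)" by (simp add: r_neg1)
  ultimately have "c = ?c" by (simp add: minus_add)
  with c have "?c \<in> jacobson_radical R" using central_in_jacobson_radical central by blast
  \<comment> \<open>The coefficient \<open>\<ominus> x\<close> cancels the sign of
    \<open>?c\<close>, which leaves \<open>x \<oplus> x\<close>.\<close>
  then have "z \<oplus> (\<ominus> x) \<otimes> ?c \<in> J_sharp R"
    using J_sharp_add_central_multiple[OF z] x central by blast
  moreover have "(\<ominus> x) \<otimes> ?c = x \<oplus> x" using x by (simp add: l_minus r_minus r_distr minus_add)
  ultimately show ?thesis by simp
qed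

lemma UJ_sharp_unit_to_J_sharp:
  assumes UJ: "UJ_sharp_ring R" and e: "e \<in> carrier R" and u: "u \<in> Units R"
  shows "(e \<oplus> u) \<ominus> (\<one> \<ominus> e) \<in> J_sharp R"
proof -
  obtain z where z: "z \<in> J_sharp R" and u: "u = \<one> \<oplus> z"
    using UJ u unfolding UJ_sharp_ring_def by blast
  have "z \<in> carrier R" using z by (simp add: J_sharp_def)
  then have "(e \<oplus> u) \<ominus> (\<one> \<ominus> e) = z \<oplus> (e \<oplus> e)" using e unfolding u by algebra
  then show ?thesis using UJ_sharp_add_double[OF UJ z e] by simp
qed

lemma UJ_sharp_J_sharp_to_unit:
  assumes UJ: "UJ_sharp_ring R" and e: "e \<in> carrier R" and a: "a \<in> carrier R"
    and z: "a \<ominus> e \<in> J_sharp R"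
  shows "a \<ominus> (\<one> \<ominus> e) \<in> Units R"
proof -
  \<comment> \<open>The choice \<open>x = e - 1\<close> comes from writing
    \<open>a - (1 - e)\<close> as \<open>1 + (a - e) + 2(e - 1)\<close>.\<close>
  have "(a \<ominus> e) \<oplus> ((e \<ominus> \<one>) \<oplus> (e \<ominus> \<one>)) \<in> J_sharp R"
    using UJ_sharp_add_double[OF UJ z, of "e \<ominus> \<one>"] e by simp
  moreover have "a \<ominus> (\<one> \<ominus> e) = \<one> \<oplus> ((a \<ominus> e) \<oplus> ((e \<ominus> \<one>) \<oplus> (e \<ominus> \<one>)))"
    using e a by algebra
  ultimately show ?thesis using UJ unfolding UJ_sharp_ring_def by blast
qed

end

theorem proposition3p7:
  fixes R :: "('a, 'm) ring_scheme"
  assumes "UJ_sharp_ring R"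
  shows "(\<forall>a \<in> carrier R. clean R a \<longleftrightarrow> J_sharp_clean R a) \<and>
         (\<forall>a \<in> carrier R. strongly_clean R a \<longleftrightarrow> strongly_J_sharp_clean R a)"
proof -
  interpret ring R using assms by (simp add: UJ_sharp_ring_def)
  have carr: "e \<in> carrier R" if "e \<in> idempotents R" for e using that by (simp add: idempotents_def)
  \<comment> \<open>This supplies the sum of idempotent and unit in both converse
    directions.\<close>
  have decomp: "a = (\<one>\<^bsub>R\<^esub> \<ominus>\<^bsub>R\<^esub> e) \<oplus>\<^bsub>R\<^esub> (a \<ominus>\<^bsub>R\<^esub> (\<one>\<^bsub>R\<^esub> \<ominus>\<^bsub>R\<^esub> e))"
    if "a \<in> carrier R" "e \<in> carrier R" for a e using that by algebra
  have "clean R a \<longleftrightarrow> J_sharp_clean R a" if a: "a \<in> carrier R" for a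
  proof
    assume "clean R a"
    then show "J_sharp_clean R a"
      unfolding clean_def J_sharp_clean_def
      using UJ_sharp_unit_to_J_sharp[OF assms] idempotent_complement carr by blast
  next
    assume "J_sharp_clean R a"
    then obtain e where e: "e \<in> idempotents R" and z: "a \<ominus>\<^bsub>R\<^esub> e \<in> J_sharp R"
      unfolding J_sharp_clean_def by blast
    show "clean R a"
      unfolding clean_def
      by (intro bexI[of _ "\<one>\<^bsub>R\<^esub> \<ominus>\<^bsub>R\<^esub> e"] bexI[of _ "a \<ominus>\<^bsub>R\<^esub> (\<one>\<^bsub>R\<^esub> \<ominus>\<^bsub>R\<^esub> e)"]
          decomp[OF a carr[OF e]] UJ_sharp_J_sharp_to_unit[OF assms carr[OF e] a z]
          idempotent_complement[OF e])
  qed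
  moreover have "strongly_clean R a \<longleftrightarrow> strongly_J_sharp_clean R a" if a: "a \<in> carrier R" for a
  proof
    assume "strongly_clean R a"
    then obtain e u where e: "e \<in> idempotents R" and u: "u \<in> Units R" and au: "a = e \<oplus>\<^bsub>R\<^esub> u"
      and eu: "e \<otimes>\<^bsub>R\<^esub> u = u \<otimes>\<^bsub>R\<^esub> e" unfolding strongly_clean_def by blast
    \<comment> \<open>The two strong notions ask for different commutations, with the unit and with
      \<open>a\<close>. Since \<open>e\<close> commutes with itself and with \<open>u\<close>, it
      commutes with \<open>a\<close>, and so does its complement.\<close>
    have "e \<otimes>\<^bsub>R\<^esub> a = a \<otimes>\<^bsub>R\<^esub> e"
      using carr[OF e] Units_closed[OF u] eu by (simp add: au l_distr r_distr)
    then show "strongly_J_sharp_clean R a"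
      unfolding strongly_J_sharp_clean_def
      using UJ_sharp_unit_to_J_sharp[OF assms carr[OF e] u] au idempotent_complement[OF e]
        complement_commutes[OF carr[OF e] a] by blast
  next
    assume "strongly_J_sharp_clean R a"
    then obtain e where e: "e \<in> idempotents R" and z: "a \<ominus>\<^bsub>R\<^esub> e \<in> J_sharp R"
      and ea: "e \<otimes>\<^bsub>R\<^esub> a = a \<otimes>\<^bsub>R\<^esub> e" unfolding strongly_J_sharp_clean_def by blast
    let ?f = "\<one>\<^bsub>R\<^esub> \<ominus>\<^bsub>R\<^esub> e"
    have f: "?f \<in> carrier R" using carr[OF e] by simp
    have fa: "?f \<otimes>\<^bsub>R\<^esub> a = a \<otimes>\<^bsub>R\<^esub> ?f" by (rule complement_commutes[OF carr[OF e] a ea])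
    \<comment> \<open>Conversely, \<open>?f\<close> commutes with \<open>a\<close> and with itself,
      hence with the unit \<open>a - ?f\<close>.\<close>
    have "?f \<otimes>\<^bsub>R\<^esub> (a \<ominus>\<^bsub>R\<^esub> ?f) = (a \<ominus>\<^bsub>R\<^esub> ?f) \<otimes>\<^bsub>R\<^esub> ?f"
      unfolding minus_eq[of a ?f] using a f by (simp only: r_distr l_distr l_minus r_minus a_inv_closed fa)
    then show "strongly_clean R a"
      unfolding strongly_clean_def
      by (intro bexI[of _ ?f] bexI[of _ "a \<ominus>\<^bsub>R\<^esub> ?f"] conjI decomp[OF a carr[OF e]]
          UJ_sharp_J_sharp_to_unit[OF assms carr[OF e] a z] idempotent_complement[OF e])
  qed
  ultimately show ?thesis by blast
qed

end
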